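(* Let $p\in\mathbb{N}$ be a prime number. Then the extreme rays of $\mathrm{CSP}(p)$ are given by $E_{01}\in\mathbb{R}^{p\times p}$ and $\mathbf{r}=(r_{ij})\in\mathbb{R}^{p\times p}$ such that $$r_{ij}=\begin{cases}1,&\text{if }(i,j)=(0,p),\\ \frac{1}{p-|I|},&\text{if }i\in I\text{ and }j=p,\\0,&\text{otherwise,}\end{cases}$$ where $I\subseteq\{1,\dots,p-1\}$. In particular the number of extreme rays of $\mathrm{CSP}(p)$ is given by $2^{p-1}+1$.
   Context: Rows of $n\times n$ matrices are indexed by $i=0,\dots,n-1$ and columns by $j=1,\dots,n$; $E_{ij}$ denote the standard basis matrices. Let $\omega_n$ be a primitive $n$-th root of unity. For an integer $n\ge1$, $\mathrm{CSP}(n)$ is the set of matrices $A=(a_{ij})\in\mathbb{R}_{\ge 0}^{n\times n}$ such that for each $1\le k\le n$, $\sum_{0\le i<n,\,1\le j\le n}a_{ij}\,\omega_n^{ki}=\sum_{0\le i<n}\sum_{j\mid k}a_{ij}$; it is a convex rational polyhedral cone. A nonzero element of a polyhedral cone of dimension $D$ is called an extreme ray if there are $D-1$ linearly independent defining constraints that are active (hold with equality) at it. Two extreme rays that are positive multiples of each other are called equivalent, and extreme rays are counted up to equivalence.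
   Formalization: The printed r is not in CSP(p) unless I={1,…,p-1} (for I=∅ the k=1 equation reads 1=0); the formal r adds the case r_ij=1/(p-|I|) for i∈{1,…,p-1}\I and j=1. Linear independence of constraints is taken on the span of the cone. *)

theory Defs
  imports
    Complex_Main
    "HOL-Library.Function_Algebras"
    "HOL-Computational_Algebra.Primes"
begin

text \<open>
  An \<open>n \<times> n\<close> matrix is a function \<open>nat \<Rightarrow> nat \<Rightarrow> real\<close>, row index first, that vanishes unless the
  row index lies in \<open>{0..<n}\<close> and the column index in \<open>{1..n}\<close>.
\<close>

type_synonym mat = "nat \<Rightarrow> nat \<Rightarrow> real"

definition mats :: "nat \<Rightarrow> mat set" where
  "mats n = {A. \<forall>i j. A i j \<noteq> 0 \<longrightarrow> i < n \<and> 1 \<le> j \<and> j \<le> n}"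

definition smul :: "real \<Rightarrow> mat \<Rightarrow> mat" where
  "smul c A = (\<lambda>i j. c * A i j)"

interpretation mat_space: vector_space smul
  by unfold_locales (auto simp: smul_def fun_eq_iff algebra_simps)

definition unit_mat :: "nat \<Rightarrow> nat \<Rightarrow> mat" where
  "unit_mat i j = (\<lambda>i' j'. if i' = i \<and> j' = j then 1 else 0)"

definition primitive_root :: "nat \<Rightarrow> complex \<Rightarrow> bool" where
  "primitive_root n w \<longleftrightarrow> w ^ n = 1 \<and> (\<forall>m. 0 < m \<and> m < n \<longrightarrow> w ^ m \<noteq> 1)"

definition csp_lhs :: "complex \<Rightarrow> nat \<Rightarrow> nat \<Rightarrow> mat \<Rightarrow> complex" where
  "csp_lhs w n k A = (\<Sum>i<n. \<Sum>j=1..n. complex_of_real (A i j) * w ^ (k * i))"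

definition csp_rhs :: "nat \<Rightarrow> nat \<Rightarrow> mat \<Rightarrow> real" where
  "csp_rhs n k A = (\<Sum>i<n. \<Sum>j\<in>{j\<in>{1..n}. j dvd k}. A i j)"

definition CSP :: "complex \<Rightarrow> nat \<Rightarrow> mat set" where
  "CSP w n = {A \<in> mats n. (\<forall>i j. 0 \<le> A i j) \<and>
     (\<forall>k\<in>{1..n}. csp_lhs w n k A = complex_of_real (csp_rhs n k A))}"

text \<open>
  The constraints defining \<open>CSP w n\<close> inside \<open>mats n\<close>, as real-valued linear functionals: those in
  \<open>csp_ineqs\<close> are required to be nonnegative and those in \<open>csp_eqs\<close> (real and imaginary part of
  each complex equation) to vanish.
\<close>

definition csp_ineqs :: "nat \<Rightarrow> (mat \<Rightarrow> real) set" where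
  "csp_ineqs n = {\<lambda>A. A i j |i j. i < n \<and> 1 \<le> j \<and> j \<le> n}"

definition csp_eqs :: "complex \<Rightarrow> nat \<Rightarrow> (mat \<Rightarrow> real) set" where
  "csp_eqs w n =
     {\<lambda>A. Re (csp_lhs w n k A - complex_of_real (csp_rhs n k A)) |k. 1 \<le> k \<and> k \<le> n} \<union>
     {\<lambda>A. Im (csp_lhs w n k A - complex_of_real (csp_rhs n k A)) |k. 1 \<le> k \<and> k \<le> n}"

definition csp_constraints :: "complex \<Rightarrow> nat \<Rightarrow> (mat \<Rightarrow> real) set" where
  "csp_constraints w n = csp_ineqs n \<union> csp_eqs w n"

lemma CSP_eq_constraints:
  "CSP w n = {A \<in> mats n. (\<forall>f\<in>csp_ineqs n. 0 \<le> f A) \<and> (\<forall>f\<in>csp_eqs w n. f A = 0)}"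
proof (intro set_eqI iffI)
  fix A assume "A \<in> CSP w n"
  then show "A \<in> {A \<in> mats n. (\<forall>f\<in>csp_ineqs n. 0 \<le> f A) \<and> (\<forall>f\<in>csp_eqs w n. f A = 0)}"
    by (auto simp: CSP_def csp_ineqs_def csp_eqs_def)
next
  fix A assume A: "A \<in> {A \<in> mats n. (\<forall>f\<in>csp_ineqs n. 0 \<le> f A) \<and> (\<forall>f\<in>csp_eqs w n. f A = 0)}"
  have "0 \<le> A i j" for i j
  proof (cases "A i j = 0")
    case False
    with A have "i < n \<and> 1 \<le> j \<and> j \<le> n" by (auto simp: mats_def)
    then have "(\<lambda>A. A i j) \<in> csp_ineqs n" by (auto simp: csp_ineqs_def)
    with A show ?thesis by auto
  qed simp
  moreover have "csp_lhs w n k A = complex_of_real (csp_rhs n k A)" if k: "k \<in> {1..n}" for k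
  proof -
    have "(\<lambda>A. Re (csp_lhs w n k A - complex_of_real (csp_rhs n k A))) \<in> csp_eqs w n"
         "(\<lambda>A. Im (csp_lhs w n k A - complex_of_real (csp_rhs n k A))) \<in> csp_eqs w n"
      using k unfolding csp_eqs_def by auto
    then have "Re (csp_lhs w n k A - complex_of_real (csp_rhs n k A)) = 0"
         "Im (csp_lhs w n k A - complex_of_real (csp_rhs n k A)) = 0"
      using A by fast+
    then show ?thesis by (simp add: complex_eq_iff)
  qed
  ultimately show "A \<in> CSP w n" using A by (simp add: CSP_def)
qed

definition lin_indep_on :: "mat set \<Rightarrow> (mat \<Rightarrow> real) set \<Rightarrow> bool" where
  "lin_indep_on V S \<longleftrightarrow> finite S \<and>
     (\<forall>u. (\<forall>A\<in>V. (\<Sum>f\<in>S. u f * f A) = 0) \<longrightarrow> (\<forall>f\<in>S. u f = 0))"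

text \<open>
  The dimension \<open>D\<close> of a cone is that of its linear span.  Linear independence of the constraints
  is meant on this \<open>D\<close>-dimensional span.  In particular the equations that hold on the whole cone
  restrict to \<open>0\<close> there and do not contribute to the \<open>D - 1\<close> active constraints; if they did,
  every point of a cone of large codimension would be an extreme ray.
\<close>

definition extreme_ray :: "mat set \<Rightarrow> (mat \<Rightarrow> real) set \<Rightarrow> mat \<Rightarrow> bool" where
  "extreme_ray C \<Phi> A \<longleftrightarrow> A \<in> C \<and> A \<noteq> 0 \<and>
     (\<exists>S\<subseteq>\<Phi>. lin_indep_on (mat_space.span C) S \<and> card S = mat_space.dim C - 1 \<and>
            (\<forall>f\<in>S. f A = 0))"

definition ray_equiv :: "mat set \<Rightarrow> (mat \<times> mat) set" where
  "ray_equiv R = {(A, B). A \<in> R \<and> B \<in> R \<and> (\<exists>c>0. B = smul c A)}"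

definition CSP_extreme_rays :: "complex \<Rightarrow> nat \<Rightarrow> mat set" where
  "CSP_extreme_rays w n = {A. extreme_ray (CSP w n) (csp_constraints w n) A}"

text \<open>
  Compared with the formula in the source, the third case (column 1) is added.  A matrix in
  \<open>CSP w p\<close> has equal row sums in the rows \<open>1, \<dots>, p - 1\<close>, so the column \<open>p\<close> entries force the
  column 1 entries given here.  With zeros there instead, the matrix lies outside \<open>CSP w p\<close>
  unless \<open>I = {1..p - 1}\<close>.
\<close>

definition csp_ray :: "nat \<Rightarrow> nat set \<Rightarrow> mat" where
  "csp_ray p I = (\<lambda>i j.
     if i = 0 \<and> j = p then 1
     else if i \<in> I \<and> j = p then 1 / (real p - real (card I))
     else if i \<in> {1..p - 1} - I \<and> j = 1 then 1 / (real p - real (card I))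
     else 0)"

end

theory Submission
  imports Defs
begin

text \<open>
  Why the theorem holds.  Only the divisors \<open>1\<close> and \<open>p\<close> of \<open>p\<close> occur in the equation for
  \<open>k = p\<close>; its left-hand side is the sum of all entries, so by nonnegativity it says that the
  columns strictly between \<open>1\<close> and \<open>p\<close> vanish.  For \<open>k < p\<close> the right-hand side is the sum of
  column 1, independently of \<open>k\<close>: the discrete Fourier transform of the row sums is constant away
  from \<open>0\<close>.  By Fourier inversion this means that the rows \<open>1, \<dots>, p - 1\<close> have a common sum \<open>r\<close>
  and that the sum of row 0 exceeds \<open>r\<close> by the sum of column 1 (\<open>fourier_constant_iff\<close>,
  \<open>CSP_prime_iff\<close>).  Hence the cone consists of the matrices with entries
  \<open>a\<^sub>0\<^sub>1\<close>, \<open>x\<^sub>i = a\<^sub>i\<^sub>1\<close>, \<open>y\<^sub>i = a\<^sub>i\<^sub>p\<close> and \<open>a\<^sub>0\<^sub>p\<close>, all nonnegative, such that \<open>x\<^sub>i + y\<^sub>i = r\<close> for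
  \<open>1 \<le> i < p\<close> and \<open>a\<^sub>0\<^sub>p = \<Sum>\<^sub>i x\<^sub>i + r\<close>.

  The numbers \<open>a\<^sub>0\<^sub>1\<close>, \<open>r\<close> and \<open>x\<^sub>1, \<dots>, x\<^sub>p\<^sub>-\<^sub>1\<close> are free coordinates on the span of the cone, so its
  dimension is \<open>p + 1\<close> (\<open>dim_CSP_prime\<close>), and the section \<open>a\<^sub>0\<^sub>1 = 0\<close>, \<open>r = 1\<close> is a cube with
  the \<open>2\<^sup>p\<^sup>-\<^sup>1\<close> vertices \<open>x \<in> {0, 1}\<^sup>p\<^sup>-\<^sup>1\<close>.  These vertices are the rays \<open>csp_ray p I\<close>, up to
  scaling, and the remaining ray is the direction of \<open>a\<^sub>0\<^sub>1\<close>.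

  An extreme ray needs \<open>p\<close> independent active constraints.  A constraint that vanishes on the
  whole span cannot belong to an independent family, so only the entries \<open>a\<^sub>0\<^sub>1, x\<^sub>i, y\<^sub>i, a\<^sub>0\<^sub>p\<close>
  count.  If \<open>r > 0\<close>, then \<open>a\<^sub>0\<^sub>p > 0\<close> and at most one of \<open>x\<^sub>i, y\<^sub>i\<close> vanishes for each \<open>i\<close>;
  reaching \<open>p\<close> zeros forces \<open>a\<^sub>0\<^sub>1 = 0\<close> and exactly one zero in each pair, that is, a vertex of
  the cube.  If \<open>r = 0\<close>, everything but \<open>a\<^sub>0\<^sub>1\<close> vanishes (\<open>extreme_ray_classified\<close>).
  Conversely, for each listed ray one exhibits \<open>p\<close> vanishing entries and, for each of them, an
  element of the span on which only that entry is nonzero (\<open>csp_ray_extreme\<close>,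
  \<open>unit_mat_extreme\<close>).
\<close>

section \<open>Fourier transforms that are constant off zero\<close>

lemma sum_primitive_root_powers:
  assumes w: "primitive_root n w" and d: "\<not> n dvd d"
  shows "(\<Sum>k<n. w ^ (k * d)) = 0"
proof (cases "n = 0")
  case False
  then have "n > 0" by simp
  have wn: "w ^ n = 1" using w by (simp add: primitive_root_def)
  have "w ^ d = w ^ (n * (d div n) + d mod n)"
    by simp
  also have "\<dots> = w ^ (d mod n)"
    by (simp only: power_add power_mult wn power_one mult_1_left)
  finally have "w ^ d \<noteq> 1"
    using w d \<open>n > 0\<close> by (simp add: primitive_root_def mod_greater_zero_iff_not_dvd)
  moreover have "(w ^ d) ^ n = 1"
    by (metis wn power_mult mult.commute power_one)
  ultimately show ?thesis
    by (simp add: power_mult mult.commute[of _ d] sum_gp_strict)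
qed simp

text \<open>
  The Fourier transform of the function that is \<open>c\<close> at \<open>0\<close> and \<open>0\<close> elsewhere is the constant \<open>c\<close>,
  and a transform vanishes away from \<open>0\<close> only for constant functions; \<open>R\<close> is the sum of a function of
  either kind.  The direction from left to right inverts the transform.
\<close>

lemma fourier_constant_iff:
  assumes w: "primitive_root n w" and n: "n > 0"
  shows "(\<forall>k\<in>{1..<n}. (\<Sum>i<n. complex_of_real (R i) * w ^ (k * i)) = complex_of_real c) \<longleftrightarrow>
         (\<forall>i\<in>{1..<n}. R i = R 0 - c)"
    (is "(\<forall>k\<in>_. ?F k = _) \<longleftrightarrow> _")
proof
  assume F: "\<forall>k\<in>{1..<n}. ?F k = complex_of_real c"
  have wn: "w ^ n = 1" using w by (simp add: primitive_root_def)
  have split0: "{..<n} = insert 0 {1..<n}" using n by auto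
  \<comment> \<open>Fourier inversion at \<open>m\<close>, where \<open>n - m\<close> stands for the exponent \<open>- m\<close>.  The \<open>- 1\<close> corrects
      for the term \<open>k = 0\<close>, in which the transform is not \<open>c\<close>.\<close>
  have inv: "complex_of_real (real n * R m) =
      ?F 0 + of_real c * ((\<Sum>k<n. w ^ (k * (n - m))) - 1)" if m: "m < n" for m
  proof -
    have "(\<Sum>k<n. w ^ (k * (n - m)) * ?F k) =
        (\<Sum>k<n. \<Sum>i<n. of_real (R i) * w ^ (k * (i + (n - m))))"
      by (simp add: sum_distrib_left power_add algebra_simps)
    also have "\<dots> = (\<Sum>i<n. of_real (R i) * (\<Sum>k<n. w ^ (k * (i + (n - m)))))"
      by (subst sum.swap) (simp add: sum_distrib_left)
    also have "\<dots> = (\<Sum>i<n. if i = m then of_real (R i) * of_nat n else 0)"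
    proof (rule sum.cong)
      fix i assume "i \<in> {..<n}"
      then have i: "i < n" by simp
      show "of_real (R i) * (\<Sum>k<n. w ^ (k * (i + (n - m)))) =
          (if i = m then of_real (R i) * of_nat n else 0)"
      proof (cases "i = m")
        case True
        then have "i + (n - m) = n" using m by simp
        moreover have "w ^ (k * n) = 1" for k by (metis wn power_mult mult.commute power_one)
        ultimately show ?thesis using True by simp
      next
        case False
        have "\<not> n dvd i + (n - m)"
        proof
          assume "n dvd i + (n - m)"
          then obtain q where q: "i + (n - m) = n * q" by blast
          moreover have "0 < i + (n - m)" "i + (n - m) < 2 * n" using i m by linarith+
          ultimately have "q = 1"
            by (metis One_nat_def less_2_cases mult.commute mult_0_right nat_mult_less_cancel_disj not_less0)
          with q False m show False by simp
        qed
        with False w show ?thesis by (simp add: sum_primitive_root_powers)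
      qed
    qed simp
    also have "\<dots> = of_real (real n * R m)" using m by simp
    finally have "complex_of_real (real n * R m) = (\<Sum>k<n. w ^ (k * (n - m)) * ?F k)" ..
    also have "\<dots> = ?F 0 + (\<Sum>k\<in>{1..<n}. w ^ (k * (n - m)) * of_real c)"
      using F unfolding split0 by simp
    also have "(\<Sum>k\<in>{1..<n}. w ^ (k * (n - m)) * of_real c) =
        of_real c * ((\<Sum>k<n. w ^ (k * (n - m))) - 1)"
      unfolding split0 by (simp add: sum_distrib_left mult.commute)
    finally show ?thesis .
  qed
  have 0: "complex_of_real (real n * R 0) = ?F 0 + of_real c * (of_nat n - 1)"
    using inv[of 0] n wn by (simp add: mult.commute[of _ n] power_mult)
  show "\<forall>i\<in>{1..<n}. R i = R 0 - c"
  proof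
    fix i assume i: "i \<in> {1..<n}"
    then have "\<not> n dvd n - i" by (auto dest: dvd_imp_le)
    then have Ri: "complex_of_real (real n * R i) = ?F 0 - of_real c"
      using inv[of i] i w by (simp add: sum_primitive_root_powers)
    have "complex_of_real (real n * R 0 - real n * R i) = complex_of_real (real n * c)"
      unfolding of_real_diff 0 Ri by (simp add: algebra_simps)
    then have "real n * R i = real n * (R 0 - c)"
      by (simp only: of_real_eq_iff) (simp add: algebra_simps)
    then show "R i = R 0 - c" using n by simp
  qed
next
  assume R: "\<forall>i\<in>{1..<n}. R i = R 0 - c"
  show "\<forall>k\<in>{1..<n}. ?F k = of_real c"
  proof
    fix k assume k: "k \<in> {1..<n}"
    then have "\<not> n dvd k" by (auto dest: dvd_imp_le)
    then have "(\<Sum>i<n. w ^ (k * i)) = 0"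
      using sum_primitive_root_powers[OF w, of k] by (simp add: mult.commute[of k])
    moreover have "?F k = (\<Sum>i<n. of_real (R 0 - c) * w ^ (k * i) + (if i = 0 then of_real c else 0))"
      using R by (intro sum.cong) auto
    ultimately show "?F k = of_real c"
      using n by (simp add: sum.distrib flip: sum_distrib_left)
  qed
qed

section \<open>The cone for a prime\<close>

text \<open>
  The linear equations of the cone in solved form; \<open>r\<close> is the common sum of the rows
  \<open>1, \<dots>, p - 1\<close>.
\<close>

definition CSP_prime_eqs :: "nat \<Rightarrow> mat \<Rightarrow> real \<Rightarrow> bool" where
  "CSP_prime_eqs p A r \<longleftrightarrow>
  (\<forall>i j. 1 < j \<and> j < p \<longrightarrow> A i j = 0) \<and>
  (\<forall>i\<in>{1..<p}. A i 1 + A i p = r) \<and> A 0 p = (\<Sum>i\<in>{1..<p}. A i 1) + r"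

lemma sum_columns:
  assumes "\<And>j. 1 < j \<Longrightarrow> j < p \<Longrightarrow> f j = (0::real)" and "1 < (p::nat)"
  shows "(\<Sum>j=1..p. f j) = f 1 + f p"
proof -
  have "(\<Sum>j=1..p. f j) = (\<Sum>j\<in>{1,p}. f j)"
    using assms by (intro sum.mono_neutral_right) auto
  with assms show ?thesis by simp
qed

lemma mats_zero:
  assumes "A \<in> mats n" "n \<le> i \<or> j < 1 \<or> n < j"
  shows "A i j = 0"
  using assms unfolding mats_def by force

lemma CSP_prime_entry_zero:
  assumes "A \<in> mats p" "CSP_prime_eqs p A r" "i \<ge> p \<or> j \<noteq> 1 \<and> j \<noteq> p"
  shows "A i j = 0"
proof (cases "i \<ge> p \<or> j < 1 \<or> p < j")
  case True
  with assms(1) show ?thesis by (rule mats_zero)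
next
  case False
  then have "1 < j \<and> j < p" using assms(3) by linarith
  with assms(2) show ?thesis by (simp add: CSP_prime_eqs_def)
qed

text \<open>
  The equation for \<open>k = p\<close> equates the sum of all entries with the sum of columns \<open>1\<close> and \<open>p\<close>.
  Once the other columns vanish, the equations for \<open>k < p\<close> fix the Fourier transform of the row
  sums, since the divisors of \<open>k\<close> other than \<open>1\<close> contribute only vanishing columns.
\<close>

lemma CSP_prime_iff:
  assumes p: "prime p" and w: "primitive_root p w"
  shows "A \<in> CSP w p \<longleftrightarrow> A \<in> mats p \<and> (\<forall>i j. 0 \<le> A i j) \<and> (\<exists>r. CSP_prime_eqs p A r)"
proof (cases "A \<in> mats p \<and> (\<forall>i j. 0 \<le> A i j)")
  case False
  then show ?thesis by (auto simp: CSP_def)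
next
  case True
  then have m: "A \<in> mats p" and nn: "0 \<le> A i j" for i j by auto
  have p1: "1 < p" using p by (rule prime_gt_1_nat)
  define R where "R = (\<lambda>i. \<Sum>j=1..p. A i j)"
  define C where "C = (\<lambda>j. \<Sum>i<p. A i j)"
  have split0: "{..<p} = insert 0 {1..<p}" using p1 by auto
  have lhs: "csp_lhs w p k A = (\<Sum>i<p. of_real (R i) * w ^ (k * i))" for k
    by (simp add: csp_lhs_def R_def sum_distrib_right)
  have wp: "w ^ (p * i) = 1" for i
    using w by (simp add: primitive_root_def power_mult)
  have rhs: "csp_rhs p k A = (\<Sum>j\<in>{j\<in>{1..p}. j dvd k}. C j)" for k
    unfolding csp_rhs_def C_def by (rule sum.swap)
  have divp: "{j\<in>{1..p}. j dvd p} = {1, p}" using p p1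
    by (auto simp: prime_nat_iff)
  have eqp: "csp_lhs w p p A = of_real (csp_rhs p p A) \<longleftrightarrow> (\<Sum>i<p. R i) = C 1 + C p"
  proof -
    have "csp_lhs w p p A = of_real (\<Sum>i<p. R i)" by (simp add: lhs wp)
    moreover have "csp_rhs p p A = C 1 + C p" unfolding rhs divp using p1 by simp
    ultimately show ?thesis by (simp only: of_real_eq_iff)
  qed
  have tot: "(\<Sum>i<p. R i) = (\<Sum>j=1..p. C j)"
    unfolding R_def C_def by (rule sum.swap)
  have Cnn: "0 \<le> C j" for j by (simp add: C_def nn sum_nonneg)
  have rest: "(\<Sum>j=1..p. C j) = C 1 + C p + (\<Sum>j\<in>{1<..<p}. C j)"
  proof -
    have "{1..p} = insert 1 (insert p {1<..<p})" using p1 by auto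
    with p1 show ?thesis by simp
  qed
  have mid: "(\<Sum>i<p. R i) = C 1 + C p \<longleftrightarrow> (\<forall>i j. 1 < j \<and> j < p \<longrightarrow> A i j = 0)"
  proof -
    have "(\<Sum>i<p. R i) = C 1 + C p \<longleftrightarrow> (\<forall>j\<in>{1<..<p}. C j = 0)"
      unfolding tot rest using Cnn by (simp add: sum_nonneg_eq_0_iff)
    also have "\<dots> \<longleftrightarrow> (\<forall>j\<in>{1<..<p}. \<forall>i<p. A i j = 0)"
      unfolding C_def using nn by (simp add: sum_nonneg_eq_0_iff Ball_def)
    also have "\<dots> \<longleftrightarrow> (\<forall>i j. 1 < j \<and> j < p \<longrightarrow> A i j = 0)"
    proof (intro iffI allI impI ballI)
      fix i j assume "\<forall>j\<in>{1<..<p}. \<forall>i<p. A i j = 0" "1 < j \<and> j < p"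
      then show "A i j = 0" using mats_zero[OF m] by (cases "i < p") auto
    qed auto
    finally show ?thesis .
  qed
  show ?thesis
  proof (cases "\<forall>i j. 1 < j \<and> j < p \<longrightarrow> A i j = 0")
    case False
    then have "A \<notin> CSP w p" using eqp mid p1 by (auto simp: CSP_def)
    with False show ?thesis by (auto simp: CSP_prime_eqs_def)
  next
    case Z: True
    have Rs: "R i = A i 1 + A i p" for i
      unfolding R_def using Z p1 by (intro sum_columns) auto
    have rk: "csp_rhs p k A = C 1" if k: "k \<in> {1..<p}" for k
    proof -
      have "(\<Sum>j\<in>{j\<in>{1..p}. j dvd k}. C j) = (\<Sum>j\<in>{1}. C j)"
      proof (rule sum.mono_neutral_right)
        show "\<forall>j\<in>{j\<in>{1..p}. j dvd k} - {1}. C j = 0"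
        proof
          fix j assume j: "j \<in> {j\<in>{1..p}. j dvd k} - {1}"
          then have "j \<le> k" using k by (auto intro: dvd_imp_le)
          then have "1 < j \<and> j < p" using j k by auto
          then show "C j = 0" using Z by (simp add: C_def)
        qed
      qed (use p1 in auto)
      then show ?thesis by (simp add: rhs)
    qed
    have "{1..p} = insert p {1..<p}" using p1 by auto
    then have "A \<in> CSP w p \<longleftrightarrow> (\<forall>k\<in>{1..<p}. csp_lhs w p k A = of_real (csp_rhs p k A))"
      using m nn eqp mid Z by (simp add: CSP_def)
    also have "\<dots> \<longleftrightarrow> (\<forall>k\<in>{1..<p}. (\<Sum>i<p. of_real (R i) * w ^ (k * i)) = complex_of_real (C 1))"
      by (simp add: lhs rk)
    also have "\<dots> \<longleftrightarrow> (\<forall>i\<in>{1..<p}. R i = R 0 - C 1)"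
      using w p1 by (intro fourier_constant_iff) auto
    also have "\<dots> \<longleftrightarrow> (\<exists>r. CSP_prime_eqs p A r)"
    proof -
      have C1: "C 1 = A 0 1 + (\<Sum>i\<in>{1..<p}. A i 1)" unfolding C_def split0 by simp
      have "CSP_prime_eqs p A r \<longleftrightarrow>
          (\<forall>i\<in>{1..<p}. A i 1 + A i p = r) \<and> A 0 p = (\<Sum>i\<in>{1..<p}. A i 1) + r" for r
        using Z by (simp add: CSP_prime_eqs_def)
      then have "CSP_prime_eqs p A r \<longleftrightarrow> (\<forall>i\<in>{1..<p}. R i = r) \<and> r = R 0 - C 1" for r
        unfolding Rs C1 by auto
      then show ?thesis by auto
    qed
    finally show ?thesis using m nn by simp
  qed
qed

section \<open>The generating matrices\<close>

lemma csp_ray_entries: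
  assumes "1 < p" "I \<subseteq> {1..p - 1}"
  shows "csp_ray p I 0 p = 1" "csp_ray p I 0 (Suc 0) = 0"
    "i \<in> {1..<p} \<Longrightarrow> csp_ray p I i p = (if i \<in> I then 1 / (real p - real (card I)) else 0)"
    "i \<in> {1..<p} \<Longrightarrow> csp_ray p I i (Suc 0) = (if i \<in> I then 0 else 1 / (real p - real (card I)))"
    "i \<ge> p \<or> j \<noteq> 1 \<and> j \<noteq> p \<Longrightarrow> csp_ray p I i j = 0"
  using assms by (auto simp: csp_ray_def)

lemma card_subset_less:
  assumes "1 < (p::nat)" "I \<subseteq> {1..p - 1}"
  shows "card I < p"
proof -
  have "card I \<le> card {1..p - 1}" using assms by (intro card_mono) auto
  with assms show ?thesis by simp
qed

lemma sum_off_subset: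
  assumes "1 < (p::nat)" "I \<subseteq> {1..p - 1}" "\<And>i. i \<in> {1..<p} \<Longrightarrow> f i = (if i \<in> I then 0 else r)"
  shows "(\<Sum>i\<in>{1..<p}. f i) = (real p - 1 - real (card I)) * r"
proof -
  have sub: "I \<subseteq> {1..<p}" using assms(2) by (rule subset_trans) (use assms(1) in auto)
  then have fin: "finite I" by (rule finite_subset) simp
  have "(\<Sum>i\<in>{1..<p}. f i) = (\<Sum>i\<in>{1..<p} - I. r)"
    using assms(3) by (intro sum.mono_neutral_cong_right) auto
  also have "\<dots> = real (card ({1..<p} - I)) * r" by simp
  also have "card ({1..<p} - I) = p - 1 - card I"
    using card_Diff_subset[OF fin sub] by simp
  also have "real (p - 1 - card I) = real p - 1 - real (card I)"
    using card_subset_less[OF assms(1,2)] assms(1) by linarith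
  finally show ?thesis .
qed

lemma csp_ray_nonneg:
  assumes "1 < p" "I \<subseteq> {1..p - 1}"
  shows "0 \<le> csp_ray p I i j"
  using card_subset_less[OF assms] by (simp add: csp_ray_def)

lemma csp_ray_in_CSP:
  assumes p: "prime p" and w: "primitive_root p w" and I: "I \<subseteq> {1..p - 1}"
  shows "csp_ray p I \<in> CSP w p"
proof -
  have p1: "1 < p" using p by (rule prime_gt_1_nat)
  note e = csp_ray_entries[OF p1 I]
  let ?r = "1 / (real p - real (card I))"
  have c: "card I < p" using p1 I by (rule card_subset_less)
  have "(\<Sum>i\<in>{1..<p}. csp_ray p I i 1) = (real p - 1 - real (card I)) * ?r"
    using p1 I by (rule sum_off_subset) (simp add: e(4))
  then have "csp_ray p I 0 p = (\<Sum>i\<in>{1..<p}. csp_ray p I i 1) + ?r"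
    using c by (simp add: e(1) field_simps)
  then have "CSP_prime_eqs p (csp_ray p I) ?r"
    unfolding CSP_prime_eqs_def using e by auto
  moreover have "csp_ray p I i j \<noteq> 0 \<Longrightarrow> i < p \<and> 1 \<le> j \<and> j \<le> p" for i j
    using p1 e(5)[of i j] by (cases "i \<ge> p \<or> j \<noteq> 1 \<and> j \<noteq> p") auto
  then have "csp_ray p I \<in> mats p" by (simp add: mats_def)
  ultimately show ?thesis
    using csp_ray_nonneg[OF p1 I] by (auto simp: CSP_prime_iff[OF p w])
qed

lemma unit_mat_in_CSP:
  assumes p: "prime p" and w: "primitive_root p w"
  shows "unit_mat 0 1 \<in> CSP w p"
proof -
  have p1: "1 < p" using p by (rule prime_gt_1_nat)
  have "CSP_prime_eqs p (unit_mat 0 1) 0"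
    using p1 by (auto simp: CSP_prime_eqs_def unit_mat_def)
  moreover have "unit_mat 0 1 \<in> mats p"
    using p1 by (auto simp: mats_def unit_mat_def split: if_splits)
  ultimately show ?thesis
    by (auto simp: CSP_prime_iff[OF p w] unit_mat_def)
qed

section \<open>Dimension\<close>

text \<open>
  Kernels of linear functionals are subspaces.  In this form an equation passes from the cone to
  its linear span.
\<close>

lemma subspace_csp_eq:
  assumes "f \<in> csp_eqs w n"
  shows "mat_space.subspace {A. f A = 0}"
proof -
  define g where "g = (\<lambda>k A. csp_lhs w n k A - complex_of_real (csp_rhs n k A))"
  have g_add: "g k (A + B) = g k A + g k B" for k A B
    by (simp add: g_def csp_lhs_def csp_rhs_def sum.distrib distrib_right)
  have g_zero: "g k 0 = 0" for k
    by (simp add: g_def csp_lhs_def csp_rhs_def)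
  have g_smul: "g k (smul c A) = of_real c * g k A" for k c A
    by (simp add: g_def csp_lhs_def csp_rhs_def smul_def sum_distrib_left mult.assoc
        right_diff_distrib)
  obtain k where "f = (\<lambda>A. Re (g k A)) \<or> f = (\<lambda>A. Im (g k A))"
    using assms by (auto simp: csp_eqs_def g_def)
  then show ?thesis
    by (elim disjE) (simp_all add: mat_space.subspace_def g_add g_zero g_smul)
qed

lemma subspace_entry: "mat_space.subspace {A. A i j = (0::real)}"
  by (auto simp: mat_space.subspace_def smul_def)

text \<open>
  On the span, \<open>A 0 p - 2 * (\<Sum>i. A i 1)\<close> equals \<open>r - \<Sum>\<^sub>i x\<^sub>i\<close>.  This is the functional that
  separates the ray with \<open>x = 0\<close> from the other basis elements in \<open>dim_CSP_prime\<close>.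
\<close>

lemma subspace_ray_weight:
  "mat_space.subspace {A. A 0 p = 2 * (\<Sum>i\<in>{1..<p}. A i (Suc 0) :: real)}"
  by (auto simp: mat_space.subspace_def smul_def sum.distrib sum_distrib_left algebra_simps)

text \<open>
  Independence is shown with dual functionals, one for each basis element; only their kernels
  matter, so the lemma speaks of subspaces.
\<close>

lemma independent_if_separated:
  assumes "\<And>b. b \<in> B \<Longrightarrow> \<exists>U. mat_space.subspace U \<and> b \<notin> U \<and> B - {b} \<subseteq> U"
  shows "mat_space.independent B"
  unfolding mat_space.dependent_def
proof
  assume "\<exists>b\<in>B. b \<in> mat_space.span (B - {b})"
  then obtain b where b: "b \<in> B" "b \<in> mat_space.span (B - {b})" by (elim bexE)
  obtain U where U: "mat_space.subspace U" "b \<notin> U" "B - {b} \<subseteq> U"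
    using assms[OF b(1)] by (elim exE conjE)
  have "mat_space.span (B - {b}) \<subseteq> U" using U(3,1) by (rule mat_space.span_minimal)
  with b(2) U(2) show False by (simp add: subset_iff)
qed

text \<open>
  The basis consists of \<open>E\<^sub>0\<^sub>1\<close>, the ray with \<open>x = 0\<close> and, for each \<open>i\<close>, the ray \<open>M i\<close> on which \<open>x\<^sub>i\<close> is
  the only nonzero \<open>x\<close>.  Since \<open>M i\<close> has row sum \<open>1 / 2\<close>, a matrix of the cone has the coefficients
  \<open>a\<^sub>0\<^sub>1\<close>, \<open>r - \<Sum>\<^sub>i x\<^sub>i\<close> and \<open>2 x\<^sub>i\<close>.  The second one may be negative, but only the span is
  concerned.
\<close>

lemma dim_CSP_prime:
  assumes p: "prime p" and w: "primitive_root p w"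
  shows "mat_space.dim (CSP w p) = p + 1"
proof -
  have p1: "1 < p" using p by (rule prime_gt_1_nat)
  define J where "J = {1..<p}"
  have JJ: "J = {1..p - 1}" using p1 by (auto simp: J_def)
  have cJ: "card J = p - 1" "finite J" by (simp_all add: J_def)
  define M where "M = (\<lambda>i. csp_ray p (J - {i}))"
  define B where "B = insert (unit_mat 0 1) (insert (csp_ray p J) (M ` J))"
  have eJ: "csp_ray p J 0 p = 1" "csp_ray p J 0 (Suc 0) = 0"
    "l \<in> J \<Longrightarrow> csp_ray p J l p = 1" "l \<in> J \<Longrightarrow> csp_ray p J l (Suc 0) = 0"
    "l \<ge> p \<or> j \<noteq> 1 \<and> j \<noteq> p \<Longrightarrow> csp_ray p J l j = 0" for l j
    using csp_ray_entries[OF p1, of J] p1 by (auto simp: JJ of_nat_diff)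
  have eM: "M i 0 p = 1" "M i 0 (Suc 0) = 0"
    "l \<in> J \<Longrightarrow> M i l p = (if l = i then 0 else 1 / 2)"
    "l \<in> J \<Longrightarrow> M i l (Suc 0) = (if l = i then 1 / 2 else 0)"
    "l \<ge> p \<or> j \<noteq> 1 \<and> j \<noteq> p \<Longrightarrow> M i l j = 0" if i: "i \<in> J" for i l j
  proof -
    have "real p - real (card (J - {i})) = 2"
      using i cJ p1 by (auto simp: of_nat_diff card_gt_0_iff J_def)
    moreover have "J - {i} \<subseteq> {1..p - 1}" by (auto simp: JJ)
    note csp_ray_entries[OF p1 this]
    ultimately show "M i 0 p = 1" "M i 0 (Suc 0) = 0"
      "l \<in> J \<Longrightarrow> M i l p = (if l = i then 0 else 1 / 2)"
      "l \<in> J \<Longrightarrow> M i l (Suc 0) = (if l = i then 1 / 2 else 0)"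
      "l \<ge> p \<or> j \<noteq> 1 \<and> j \<noteq> p \<Longrightarrow> M i l j = 0"
      by (auto simp: M_def J_def)
  qed
  have sM: "2 * (\<Sum>l\<in>J. M i l (Suc 0)) = 1" if "i \<in> J" for i
    using that cJ by (simp add: eM)
  have sJ: "(\<Sum>l\<in>J. csp_ray p J l (Suc 0)) = 0" by (simp add: eJ)
  have J0: "l \<noteq> 0" if "l \<in> J" for l using that by (simp add: J_def)
  have E0: "unit_mat 0 (Suc 0) 0 p = 0" using p1 by (simp add: unit_mat_def)
  have sE: "(\<Sum>l\<in>J. unit_mat 0 1 l (Suc 0)) = 0"
    by (rule sum.neutral) (auto simp: unit_mat_def J_def)
  have injM: "inj_on M J"
  proof (rule inj_onI)
    fix i k assume "i \<in> J" "k \<in> J" "M i = M k"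
    then have "M i i (Suc 0) = M k i (Suc 0)" by simp
    then show "i = k" using eM(4) \<open>i \<in> J\<close> \<open>k \<in> J\<close> by (auto split: if_splits)
  qed
  have nM: "csp_ray p J \<notin> M ` J" using eM(4) eJ(4) by fastforce
  have nE: "unit_mat 0 1 \<notin> insert (csp_ray p J) (M ` J)"
  proof -
    have "unit_mat 0 1 0 (Suc 0) = 1" by (simp add: unit_mat_def)
    then show ?thesis using eM(2) eJ(2) by fastforce
  qed
  have cB: "card B = p + 1"
    unfolding B_def using nM nE injM cJ p1 by (simp add: card_image)
  have "mat_space.independent B"
  proof (rule independent_if_separated)
    fix b assume "b \<in> B"
    then consider "b = unit_mat 0 1" | "b = csp_ray p J" | i where "i \<in> J" "b = M i"
      by (auto simp: B_def)
    then show "\<exists>U. mat_space.subspace U \<and> b \<notin> U \<and> B - {b} \<subseteq> U"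
    proof cases
      case 1
      then show ?thesis
        by (intro exI[of _ "{A. A 0 (Suc 0) = 0}"])
           (auto simp: subspace_entry B_def eJ eM unit_mat_def)
    next
      case 2
      then show ?thesis
        using sM sJ sE
        by (intro exI[of _ "{A. A 0 p = 2 * (\<Sum>i\<in>J. A i (Suc 0))}"] conjI
            subspace_ray_weight[of p, folded J_def])
           (auto simp: B_def eJ(1) eM(1) E0)
    next
      case (3 i)
      then show ?thesis
        by (intro exI[of _ "{A. A i (Suc 0) = 0}"])
           (auto simp: subspace_entry B_def eJ eM unit_mat_def J0)
    qed
  qed
  moreover have "mat_space.span B = mat_space.span (CSP w p)"
  proof (rule antisym)
    have "B \<subseteq> CSP w p"
      using csp_ray_in_CSP[OF p w] unit_mat_in_CSP[OF p w] by (auto simp: B_def M_def JJ)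
    then show "mat_space.span B \<subseteq> mat_space.span (CSP w p)"
      by (rule mat_space.span_mono)
    show "mat_space.span (CSP w p) \<subseteq> mat_space.span B"
    proof (rule mat_space.span_minimal)
      show "CSP w p \<subseteq> mat_space.span B"
      proof
        fix A assume "A \<in> CSP w p"
        then obtain r where m: "A \<in> mats p" and r: "CSP_prime_eqs p A r"
          by (auto simp: CSP_prime_iff[OF p w])
        define s where "s = (\<Sum>i\<in>J. A i (Suc 0))"
        let ?X = "smul (A 0 (Suc 0)) (unit_mat 0 1) + smul (r - s) (csp_ray p J)"
        let ?Y = "\<Sum>i\<in>J. smul (2 * A i (Suc 0)) (M i)"
        have Y: "?Y l j = (\<Sum>i\<in>J. 2 * A i (Suc 0) * M i l j)" for l j
          by (induction J rule: infinite_finite_induct) (simp_all add: smul_def)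
        have sm: "smul c K l j = c * K l j" for c K l j by (simp add: smul_def)
        have "A l j = (?X + ?Y) l j" for l j
        proof -
          consider "l \<ge> p \<or> j \<noteq> 1 \<and> j \<noteq> p" | "l = 0" "j = Suc 0" | "l = 0" "j = p"
            | "l \<in> J" "j = Suc 0" | "l \<in> J" "j = p"
            unfolding J_def by fastforce
          then show ?thesis
          proof cases
            case 1
            then have "A l j = 0"
              using CSP_prime_entry_zero[OF m r] by simp
            with 1 show ?thesis using p1 by (auto simp: Y sm unit_mat_def eJ eM)
          next
            case 2
            then show ?thesis by (simp add: Y sm unit_mat_def eJ eM)
          next
            case 3
            have "A 0 p = s + r" using r by (simp add: CSP_prime_eqs_def s_def J_def)
            with 3 p1 show ?thesis
              by (simp add: Y sm unit_mat_def eJ eM s_def flip: sum_distrib_left)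
          next
            case 4
            then have "?Y l j = (\<Sum>i\<in>J. if i = l then A l (Suc 0) else 0)"
              unfolding Y by (intro sum.cong) (auto simp: eM)
            then have "?Y l j = A l (Suc 0)" using 4 cJ by simp
            with 4 show ?thesis by (simp add: sm unit_mat_def eJ J0)
          next
            case 5
            then have "?Y l j = (\<Sum>i\<in>J. A i (Suc 0) - (if i = l then A l (Suc 0) else 0))"
              unfolding Y by (intro sum.cong) (auto simp: eM)
            then have "?Y l j = s - A l (Suc 0)" using 5 cJ by (simp add: sum_subtractf s_def)
            moreover have "A l (Suc 0) + A l p = r" using 5 r by (auto simp: CSP_prime_eqs_def J_def)
            ultimately show ?thesis using 5 p1 by (simp add: sm unit_mat_def eJ)
          qed
        qed
        then have "A = ?X + ?Y" by blast
        moreover have "?X + ?Y \<in> mat_space.span B"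
          by (intro mat_space.span_add mat_space.span_sum mat_space.span_scale mat_space.span_base)
             (auto simp: B_def)
        ultimately show "A \<in> mat_space.span B" by simp
      qed
    qed (rule mat_space.subspace_span)
  qed
  ultimately have "mat_space.dim (CSP w p) = card B"
    by (intro mat_space.dim_eq_card) auto
  with cB show ?thesis by simp
qed

section \<open>Extreme rays\<close>

text \<open>
  A test point on which exactly one functional of a family is nonzero isolates its coefficient in
  any linear relation.
\<close>

lemma lin_indep_on_if_separated:
  assumes "finite S" and "\<And>f. f \<in> S \<Longrightarrow> \<exists>A\<in>V. f A \<noteq> 0 \<and> (\<forall>g\<in>S - {f}. g A = 0)"
  shows "lin_indep_on V S"
  unfolding lin_indep_on_def
proof (rule conjI[OF assms(1)], rule allI, rule impI)
  fix u assume u: "\<forall>A\<in>V. (\<Sum>f\<in>S. u f * f A) = 0"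
  show "\<forall>f\<in>S. u f = 0"
  proof
    fix f assume f: "f \<in> S"
    obtain A where A: "A \<in> V" "f A \<noteq> 0" "\<forall>g\<in>S - {f}. g A = 0" using assms(2)[OF f] by blast
    have "(\<Sum>g\<in>S - {f}. u g * g A) = 0"
    proof (rule sum.neutral, rule ballI)
      fix g assume "g \<in> S - {f}"
      with A(3) have "g A = 0" by blast
      then show "u g * g A = 0" by simp
    qed
    then have "(\<Sum>f\<in>S. u f * f A) = u f * f A"
      by (simp add: sum.remove[OF assms(1) f])
    with bspec[OF u A(1)] have "u f * f A = 0" by simp
    with A(2) show "u f = 0" by simp
  qed
qed

text \<open>
  This discards the equations of the cone and the entries of the vanishing columns from every
  independent family of constraints.
\<close>

lemma lin_indep_on_nonzero:
  assumes "lin_indep_on V S" "f \<in> S"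
  shows "\<exists>A\<in>V. f A \<noteq> 0"
proof (rule ccontr)
  assume "\<not> ?thesis"
  then have f0: "f A = 0" if "A \<in> V" for A using that by blast
  define u where "u = (\<lambda>g. if g = f then 1 else 0 :: real)"
  have "\<forall>A\<in>V. (\<Sum>g\<in>S. u g * g A) = 0"
    by (intro ballI sum.neutral) (simp add: u_def f0)
  then have "u f = 0"
    using assms(2) spec[OF conjunct2[OF assms(1)[unfolded lin_indep_on_def]], of u] by simp
  then show False by (simp add: u_def)
qed

abbreviation entry :: "nat \<times> nat \<Rightarrow> mat \<Rightarrow> real" where
  "entry \<equiv> \<lambda>(i, j) A. A i j"

lemma inj_entry: "inj_on entry T"
proof (rule inj_onI)
  fix x y :: "nat \<times> nat" assume "entry x = entry y"
  then have "entry x (unit_mat (fst x) (snd x)) = entry y (unit_mat (fst x) (snd x))" by simp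
  then show "x = y" by (auto simp: unit_mat_def split_beta prod_eq_iff split: if_splits)
qed

text \<open>
  The criterion by which the listed matrices are shown to be extreme: \<open>p\<close> vanishing entries, where
  \<open>p\<close> is the dimension minus one, each with a test point in the span.
\<close>

lemma extreme_ray_entriesI:
  assumes p: "prime p" and w: "primitive_root p w"
    and A: "A \<in> CSP w p" "A \<noteq> 0"
    and T: "T \<subseteq> {..<p} \<times> {1..p}" "card T = p" "\<And>i j. (i, j) \<in> T \<Longrightarrow> A i j = 0"
    and sep: "\<And>i j. (i, j) \<in> T \<Longrightarrow>
      \<exists>X\<in>mat_space.span (CSP w p). X i j \<noteq> 0 \<and> (\<forall>(k, l)\<in>T - {(i, j)}. X k l = 0)"
  shows "A \<in> CSP_extreme_rays w p"
proof -
  let ?S = "entry ` T"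
  have "finite T" using T(1) by (rule finite_subset) auto
  have "lin_indep_on (mat_space.span (CSP w p)) ?S"
  proof (rule lin_indep_on_if_separated)
    fix f assume "f \<in> ?S"
    then obtain i j where ij: "(i, j) \<in> T" and f: "f = entry (i, j)" by auto
    from sep[OF ij] show "\<exists>X\<in>mat_space.span (CSP w p). f X \<noteq> 0 \<and> (\<forall>g\<in>?S - {f}. g X = 0)"
      unfolding f by fastforce
  qed (use \<open>finite T\<close> in auto)
  moreover have "?S \<subseteq> csp_constraints w p"
  proof
    fix f assume "f \<in> ?S"
    then obtain i j where ij: "(i, j) \<in> T" and f: "f = entry (i, j)" by auto
    have "i < p" "1 \<le> j" "j \<le> p" using ij T(1) by auto
    then have "(\<lambda>A. A i j) \<in> csp_ineqs p" unfolding csp_ineqs_def by blast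
    then show "f \<in> csp_constraints w p" by (simp add: f csp_constraints_def)
  qed
  moreover have "card ?S = mat_space.dim (CSP w p) - 1"
    using T(2) by (simp add: dim_CSP_prime[OF p w] card_image[OF inj_entry])
  moreover have "\<forall>f\<in>?S. f A = 0" using T(3) by auto
  ultimately show ?thesis
    using A unfolding CSP_extreme_rays_def extreme_ray_def by blast
qed

text \<open>
  Vanishing on \<open>csp_ray p I\<close> are \<open>a\<^sub>0\<^sub>1\<close>, the \<open>x\<^sub>i\<close> with \<open>i \<in> I\<close> and the \<open>y\<^sub>i\<close> with \<open>i \<notin> I\<close>.
  The neighbouring vertices of the cube, obtained by removing \<open>i\<close> from \<open>I\<close> or adding it, make
  exactly one of these entries nonzero and serve as test points; \<open>E\<^sub>0\<^sub>1\<close> is the test point for \<open>a\<^sub>0\<^sub>1\<close>.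
\<close>

lemma csp_ray_extreme:
  assumes p: "prime p" and w: "primitive_root p w" and I: "I \<subseteq> {1..p - 1}"
  shows "csp_ray p I \<in> CSP_extreme_rays w p"
proof -
  have p1: "1 < p" using p by (rule prime_gt_1_nat)
  define z where "z = (\<lambda>i. (i, if i = 0 \<or> i \<in> I then 1 else p))"
  have sepray: "csp_ray p K \<in> mat_space.span (CSP w p)" if "K \<subseteq> {1..p - 1}" for K
    using csp_ray_in_CSP[OF p w that] by (rule mat_space.span_base)
  show ?thesis
  proof (rule extreme_ray_entriesI[OF p w, where T = "z ` {..<p}"])
    show "csp_ray p I \<in> CSP w p" using p w I by (rule csp_ray_in_CSP)
    show "csp_ray p I \<noteq> 0" using csp_ray_entries(1)[OF p1 I] by auto
    show "z ` {..<p} \<subseteq> {..<p} \<times> {1..p}" using p1 by (auto simp: z_def)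
    show "card (z ` {..<p}) = p" by (subst card_image) (auto simp: z_def inj_on_def)
    show "csp_ray p I i j = 0" if "(i, j) \<in> z ` {..<p}" for i j
      using that csp_ray_entries[OF p1 I] by (cases "i = 0") (auto simp: z_def split: if_splits)
    fix i j assume ij: "(i, j) \<in> z ` {..<p}"
    then have i: "i < p" and j: "j = (if i = 0 \<or> i \<in> I then 1 else p)" by (auto simp: z_def)
    show "\<exists>X\<in>mat_space.span (CSP w p). X i j \<noteq> 0 \<and> (\<forall>(k, l)\<in>z ` {..<p} - {(i, j)}. X k l = 0)"
    proof (cases "i = 0")
      case True
      then show ?thesis
        using j mat_space.span_base[OF unit_mat_in_CSP[OF p w]]
        by (intro bexI[of _ "unit_mat 0 1"]) (auto simp: unit_mat_def z_def)
    next
      case False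
      define K where "K = (if i \<in> I then I - {i} else insert i I)"
      have K: "K \<subseteq> {1..p - 1}" using I i False by (auto simp: K_def)
      note e = csp_ray_entries[OF p1 K] and c = card_subset_less[OF p1 K]
      have "csp_ray p K i j \<noteq> 0"
        using e(3)[of i] e(4)[of i] c i False by (auto simp: j K_def split: if_splits)
      moreover have "csp_ray p K k l = 0" if "(k, l) \<in> z ` {..<p} - {(i, j)}" for k l
      proof (cases "k = 0")
        case True
        with that e(2) show ?thesis by (auto simp: z_def)
      next
        case k: False
        from that have "k < p" "k \<noteq> i" "l = (if k \<in> I then 1 else p)"
          using k by (auto simp: z_def j)
        with k e(3)[of k] e(4)[of k] show ?thesis by (auto simp: K_def)
      qed
      ultimately show ?thesis using sepray[OF K] by blast
    qed
  qed
qed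

text \<open>
  All \<open>2 p - 1\<close> entries \<open>x\<^sub>i\<close>, \<open>y\<^sub>i\<close> and \<open>a\<^sub>0\<^sub>p\<close> vanish at \<open>E\<^sub>0\<^sub>1\<close>; the \<open>x\<^sub>i\<close> and \<open>a\<^sub>0\<^sub>p\<close> are an
  independent choice of \<open>p\<close> of them.
  The test point for \<open>a\<^sub>0\<^sub>p\<close> is the ray with \<open>x = 0\<close>.  For \<open>x\<^sub>i\<close> the ray with only \<open>x\<^sub>i\<close> nonzero also
  has \<open>a\<^sub>0\<^sub>p = 1\<close>, and subtracting the ray with \<open>x = 0\<close> removes this; the difference lies
  in the span, though not in the cone.
\<close>

lemma unit_mat_extreme:
  assumes p: "prime p" and w: "primitive_root p w"
  shows "unit_mat 0 1 \<in> CSP_extreme_rays w p"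
proof -
  have p1: "1 < p" using p by (rule prime_gt_1_nat)
  define J where "J = {1..p - 1}"
  define z where "z = (\<lambda>i::nat. (i, if i = 0 then p else 1))"
  have eJ: "csp_ray p J 0 p = 1" "l \<in> {1..<p} \<Longrightarrow> csp_ray p J l 1 = 0" for l
    using csp_ray_entries[OF p1, of J] p1 by (auto simp: J_def)
  have span: "csp_ray p K \<in> mat_space.span (CSP w p)" if "K \<subseteq> J" for K
    using csp_ray_in_CSP[OF p w] that by (auto intro: mat_space.span_base simp: J_def)
  show ?thesis
  proof (rule extreme_ray_entriesI[OF p w, where T = "z ` {..<p}"])
    show "unit_mat 0 1 \<in> CSP w p" using p w by (rule unit_mat_in_CSP)
    show "unit_mat 0 1 \<noteq> 0" by (auto simp: fun_eq_iff unit_mat_def)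
    show "z ` {..<p} \<subseteq> {..<p} \<times> {1..p}" using p1 by (auto simp: z_def)
    show "card (z ` {..<p}) = p" by (subst card_image) (auto simp: z_def inj_on_def)
    show "unit_mat 0 1 i j = 0" if "(i, j) \<in> z ` {..<p}" for i j
      using that p1 by (auto simp: z_def unit_mat_def)
    fix i j assume ij: "(i, j) \<in> z ` {..<p}"
    then have i: "i < p" and j: "j = (if i = 0 then p else 1)" by (auto simp: z_def)
    show "\<exists>X\<in>mat_space.span (CSP w p). X i j \<noteq> 0 \<and> (\<forall>(k, l)\<in>z ` {..<p} - {(i, j)}. X k l = 0)"
    proof (cases "i = 0")
      case True
      have "csp_ray p J i j \<noteq> 0" using True j eJ(1) by simp
      moreover have "csp_ray p J k l = 0" if "(k, l) \<in> z ` {..<p} - {(i, j)}" for k l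
      proof -
        from that True have "k \<in> {1..<p}" "l = 1" by (cases "k = 0"; auto simp: z_def j)+
        with eJ(2) show ?thesis by simp
      qed
      ultimately show ?thesis using span[of J] by blast
    next
      case False
      have K: "J - {i} \<subseteq> {1..p - 1}" by (auto simp: J_def)
      note e = csp_ray_entries[OF p1 K] and c = card_subset_less[OF p1 K]
      let ?X = "csp_ray p (J - {i}) - csp_ray p J"
      have "?X \<in> mat_space.span (CSP w p)" by (intro mat_space.span_diff span) auto
      moreover have "?X i j \<noteq> 0"
        using e(4)[of i] eJ(2)[of i] c i False by (auto simp: j)
      moreover have "?X k l = 0" if "(k, l) \<in> z ` {..<p} - {(i, j)}" for k l
      proof (cases "k = 0")
        case True
        with that e(1) eJ(1) show ?thesis by (auto simp: z_def)
      next
        case k: False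
        from that have "k < p" "k \<noteq> i" "l = 1"
          using k by (auto simp: z_def j)
        with k e(4)[of k] eJ(2)[of k] show ?thesis by (auto simp: J_def)
      qed
      ultimately show ?thesis by blast
    qed
  qed
qed

lemma smul_extreme:
  assumes p: "prime p" and w: "primitive_root p w"
    and A: "A \<in> CSP_extreme_rays w p" and c: "0 < c"
  shows "smul c A \<in> CSP_extreme_rays w p"
proof -
  obtain S where A: "A \<in> CSP w p" "A \<noteq> 0" and
    S: "S \<subseteq> csp_constraints w p" "lin_indep_on (mat_space.span (CSP w p)) S"
    "card S = mat_space.dim (CSP w p) - 1" "\<forall>f\<in>S. f A = 0"
    using A unfolding CSP_extreme_rays_def extreme_ray_def by blast
  have sub: "mat_space.subspace {A. f A = 0}" if "f \<in> csp_constraints w p" for f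
    using that subspace_csp_eq subspace_entry by (auto simp: csp_constraints_def csp_ineqs_def)
  have 0: "f (smul c A) = 0" if "f \<in> csp_constraints w p" "f A = 0" for f
    using mat_space.subspace_scale[OF sub[OF that(1)], of A c] that(2) by simp
  have "smul c A \<in> CSP w p"
  proof -
    have "smul c A \<in> mats p" using A(1) by (auto simp: CSP_def mats_def smul_def)
    moreover have "0 \<le> smul c A i j" for i j using A(1) c by (simp add: CSP_def smul_def)
    then have "\<forall>f\<in>csp_ineqs p. 0 \<le> f (smul c A)" by (auto simp: csp_ineqs_def)
    moreover have "\<forall>f\<in>csp_eqs w p. f (smul c A) = 0"
    proof
      fix f assume f: "f \<in> csp_eqs w p"
      then have "f A = 0" using A(1) unfolding CSP_eq_constraints by blast
      with f show "f (smul c A) = 0" using 0[of f] by (simp add: csp_constraints_def)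
    qed
    ultimately show ?thesis by (simp add: CSP_eq_constraints)
  qed
  moreover have "smul c A \<noteq> 0" using A(2) c by (auto simp: smul_def fun_eq_iff)
  moreover have "\<forall>f\<in>S. f (smul c A) = 0"
  proof
    fix f assume "f \<in> S"
    with S(1,4) show "f (smul c A) = 0" using 0[of f] by blast
  qed
  ultimately show ?thesis
    using S(1-3) unfolding CSP_extreme_rays_def extreme_ray_def by blast
qed

text \<open>
  A counting argument replaces linear algebra here: an independent family of \<open>p\<close> active constraints
  contains at least \<open>p\<close> vanishing entries that are not identically zero on the span, and for
  \<open>r > 0\<close> there are at most \<open>p\<close> candidates, one in each row below \<open>p\<close>.
\<close>

lemma extreme_ray_classified:
  assumes p: "prime p" and w: "primitive_root p w" and A: "A \<in> CSP_extreme_rays w p"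
  obtains c R where "0 < c" "R \<in> insert (unit_mat 0 1) (csp_ray p ` Pow {1..p - 1})" "A = smul c R"
proof -
  have p1: "1 < p" using p by (rule prime_gt_1_nat)
  let ?V = "mat_space.span (CSP w p)"
  obtain S where AC: "A \<in> CSP w p" "A \<noteq> 0" and
    S: "S \<subseteq> csp_constraints w p" "lin_indep_on ?V S" "card S = p" "\<forall>f\<in>S. f A = 0"
    using A unfolding CSP_extreme_rays_def extreme_ray_def dim_CSP_prime[OF p w] by auto
  obtain r where m: "A \<in> mats p" and nn: "\<And>i j. 0 \<le> A i j" and r: "CSP_prime_eqs p A r"
    using AC(1) by (auto simp: CSP_prime_iff[OF p w])
  have row: "A i 1 + A i p = r" if "i \<in> {1..<p}" for i
    using r that by (auto simp: CSP_prime_eqs_def)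
  have corner: "A 0 p = (\<Sum>i\<in>{1..<p}. A i 1) + r" using r by (simp add: CSP_prime_eqs_def)
  have zero: "A i j = 0" if "i \<ge> p \<or> j \<noteq> 1 \<and> j \<noteq> p" for i j
    using m r that by (rule CSP_prime_entry_zero)
  have "1 \<in> {1..<p}" using p1 by simp
  then have "0 \<le> r" using row[of 1] nn[of 1 1] nn[of 1 p] by linarith
  show thesis
  proof (cases "r = 0")
    case True
    have x: "A i 1 = 0 \<and> A i p = 0" if "i \<in> {1..<p}" for i
      using row[OF that] nn[of i 1] nn[of i p] True by linarith
    then have "A 0 p = 0" using corner True by simp
    have "A i j = smul (A 0 1) (unit_mat 0 1) i j" for i j
    proof (cases "i = 0 \<and> j = 1")
      case False
      have "A i j = 0"
        using zero[of i j] x[of i] \<open>A 0 p = 0\<close> False by (cases "i = 0"; cases "i < p") auto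
      with False show ?thesis by (auto simp: smul_def unit_mat_def)
    qed (simp add: smul_def unit_mat_def)
    then have eq: "A = smul (A 0 1) (unit_mat 0 1)" by blast
    then have "A 0 1 \<noteq> 0" using AC(2) by (metis mat_space.scale_zero_left)
    then show thesis using that[OF _ _ eq] nn[of 0 1] by auto
  next
    case False
    then have "0 < r" using \<open>0 \<le> r\<close> by simp
    \<comment> \<open>\<open>z i\<close> is the one position of row \<open>i\<close>, in column 1 or \<open>p\<close>, at which \<open>A\<close> can vanish, so the
        constraints in \<open>S\<close> inject into \<open>Z\<close>, enlarged by row 0 if \<open>a\<^sub>0\<^sub>1 = 0\<close>.\<close>
    define Z where "Z = {i \<in> {1..<p}. A i 1 = 0 \<or> A i p = 0}"
    define z where "z = (\<lambda>i. (i, if i = 0 \<or> A i 1 = 0 then 1 else p))"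
    define T where "T = z ` (Z \<union> (if A 0 1 = 0 then {0} else {}))"
    have ST: "S \<subseteq> entry ` T"
    proof
      fix f assume f: "f \<in> S"
      obtain X where X: "X \<in> ?V" "f X \<noteq> 0" using lin_indep_on_nonzero[OF S(2) f] by blast
      have "f \<notin> csp_eqs w p"
      proof
        assume fe: "f \<in> csp_eqs w p"
        then have "CSP w p \<subseteq> {A. f A = 0}" by (auto simp: CSP_eq_constraints)
        then have "?V \<subseteq> {A. f A = 0}" using subspace_csp_eq[OF fe] by (rule mat_space.span_minimal)
        with X show False by blast
      qed
      then obtain i j where f_eq: "f = (\<lambda>A. A i j)" and ij: "i < p" "1 \<le> j" "j \<le> p"
        using S(1) f by (auto simp: csp_constraints_def csp_ineqs_def)
      have "j = 1 \<or> j = p"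
      proof (rule ccontr)
        assume "\<not> (j = 1 \<or> j = p)"
        then have "CSP w p \<subseteq> {A. A i j = 0}"
          using ij by (auto simp: CSP_prime_iff[OF p w] CSP_prime_eqs_def)
        then have "?V \<subseteq> {A. A i j = 0}" using subspace_entry by (rule mat_space.span_minimal)
        with X show False by (auto simp: f_eq)
      qed
      moreover have a: "A i j = 0" using S(4) f by (auto simp: f_eq)
      moreover have "A 0 p > 0"
        unfolding corner using \<open>0 < r\<close> nn by (simp add: add_nonneg_pos sum_nonneg)
      moreover have "\<not> (A i 1 = 0 \<and> A i p = 0)" if "i \<noteq> 0"
        using row[of i] that ij \<open>0 < r\<close> by auto
      ultimately have "(i, j) = z i" "i \<in> Z \<union> (if A 0 1 = 0 then {0} else {})"
        using ij by (cases "i = 0"; auto simp: z_def Z_def)+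
      then have "(i, j) \<in> T" unfolding T_def by (metis imageI)
      then show "f \<in> entry ` T" unfolding f_eq by force
    qed
    have fZ: "finite Z" "Z \<subseteq> {1..<p}" by (auto simp: Z_def)
    then have "finite T" by (simp add: T_def)
    then have "card S \<le> card (entry ` T)" using ST by (intro card_mono) auto
    then have "p \<le> card T" by (simp only: S(3) card_image[OF inj_entry])
    also have "\<dots> \<le> card (Z \<union> (if A 0 1 = 0 then {0} else {}))"
      unfolding T_def using fZ by (intro card_image_le) auto
    also have "\<dots> \<le> card Z + (if A 0 1 = 0 then 1 else 0)"
      by (rule order_trans[OF card_Un_le]) simp
    finally have le: "p \<le> card Z + (if A 0 1 = 0 then 1 else 0)" .
    moreover have "card Z \<le> p - 1" using card_mono[OF _ fZ(2)] by simp
    ultimately have a0: "A 0 1 = 0" and "card Z = p - 1" using p1 by (auto split: if_splits)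
    then have "Z = {1..<p}" using fZ by (intro card_subset_eq) auto
    define I where "I = {i \<in> {1..<p}. A i 1 = 0}"
    have I: "I \<subseteq> {1..p - 1}" by (auto simp: I_def)
    note e = csp_ray_entries[OF p1 I] and cI = card_subset_less[OF p1 I]
    have x: "A i 1 = (if i \<in> I then 0 else r)" "A i p = (if i \<in> I then r else 0)"
      if i: "i \<in> {1..<p}" for i
    proof -
      have "i \<in> Z" using i \<open>Z = {1..<p}\<close> by simp
      then have "A i 1 = 0 \<or> A i p = 0" by (simp add: Z_def)
      moreover have "i \<in> I \<longleftrightarrow> A i 1 = 0" using i by (simp add: I_def)
      ultimately show "A i 1 = (if i \<in> I then 0 else r)" "A i p = (if i \<in> I then r else 0)"
        using row[OF i] by auto
    qed
    have c: "A 0 p = (real p - real (card I)) * r"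
      unfolding corner using sum_off_subset[OF p1 I x(1)] by (simp add: algebra_simps)
    have "A i j = smul ((real p - real (card I)) * r) (csp_ray p I) i j" for i j
    proof -
      consider "i \<ge> p \<or> j \<noteq> 1 \<and> j \<noteq> p" | "i = 0" "j = 1" | "i = 0" "j = p"
        | "i \<in> {1..<p}" "j = 1 \<or> j = p" by fastforce
      then show ?thesis
        using cI zero[of i j] a0 c x[of i] e by cases (auto simp: smul_def)
    qed
    then have "A = smul ((real p - real (card I)) * r) (csp_ray p I)" by blast
    then show thesis using cI \<open>0 < r\<close> I by (intro that) auto
  qed
qed

section \<open>Counting\<close>

text \<open>
  The equivalence classes are the rays through the elements of \<open>G\<close>, and the hypothesis says that
  distinct elements lie on distinct rays.
\<close>

lemma card_quotient_ray_equiv: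
  assumes "\<And>R R' c. R \<in> G \<Longrightarrow> R' \<in> G \<Longrightarrow> 0 < c \<Longrightarrow> R' = smul c R \<Longrightarrow> R' = R"
  defines "X \<equiv> {smul c R |c R. 0 < c \<and> R \<in> G}"
  shows "card (X // ray_equiv X) = card G"
proof -
  define h where "h = (\<lambda>R. {smul c R |c. 0 < c})"
  have sm: "smul a (smul b R) = smul (a * b) R" for a b R by (simp add: smul_def mult.assoc)
  have s1: "smul 1 R = R" for R by (simp add: smul_def)
  have cls: "ray_equiv X `` {smul c R} = h R" if "R \<in> G" "0 < c" for c R
  proof (intro set_eqI iffI)
    fix B assume "B \<in> ray_equiv X `` {smul c R}"
    then obtain d where "0 < d" "B = smul d (smul c R)" by (auto simp: ray_equiv_def)
    then show "B \<in> h R" using that unfolding h_def by (auto simp: sm intro!: exI[of _ "d * c"])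
  next
    fix B assume "B \<in> h R"
    then obtain d where d: "0 < d" "B = smul d R" by (auto simp: h_def)
    then have "B = smul (d / c) (smul c R)" using that by (simp add: sm)
    moreover have "0 < d / c" using d that by simp
    moreover have "smul c R \<in> X" "B \<in> X" unfolding X_def using d that by blast+
    ultimately show "B \<in> ray_equiv X `` {smul c R}"
      unfolding ray_equiv_def by blast
  qed
  have self: "R \<in> h R" for R unfolding h_def using s1[of R] by (metis (mono_tags) mem_Collect_eq zero_less_one)
  have "X // ray_equiv X = h ` G"
  proof (intro set_eqI iffI)
    fix Q assume "Q \<in> X // ray_equiv X"
    then obtain A where "A \<in> X" "Q = ray_equiv X `` {A}" by (rule quotientE)
    moreover from this obtain c R where "A = smul c R" "0 < c" "R \<in> G" by (auto simp: X_def)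
    ultimately show "Q \<in> h ` G" by (simp add: cls)
  next
    fix Q assume "Q \<in> h ` G"
    then obtain R where R: "R \<in> G" "Q = h R" by auto
    then have "R \<in> X" unfolding X_def using s1[of R] by (metis (mono_tags, lifting) mem_Collect_eq zero_less_one)
    moreover have "Q = ray_equiv X `` {R}" using R cls[of R 1] by (simp add: s1)
    ultimately show "Q \<in> X // ray_equiv X" by (auto intro: quotientI)
  qed
  moreover have "inj_on h G"
  proof (rule inj_onI)
    fix R R' assume R: "R \<in> G" "R' \<in> G" "h R = h R'"
    then have "R' \<in> h R" using self by simp
    then obtain c where "0 < c" "R' = smul c R" unfolding h_def by blast
    with R(1,2) have "R' = R" by (rule assms(1))
    then show "R = R'" by simp
  qed
  ultimately show ?thesis by (simp add: card_image)
qed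

theorem corollary7p5:
  fixes p :: nat and w :: complex
  assumes "prime p" and "primitive_root p w"
  shows "CSP_extreme_rays w p =
           {smul c R |c R. 0 < c \<and> R \<in> insert (unit_mat 0 1) (csp_ray p ` Pow {1..p - 1})} \<and>
         card (CSP_extreme_rays w p // ray_equiv (CSP_extreme_rays w p)) = 2 ^ (p - 1) + 1"
proof -
  have p1: "1 < p" using assms(1) by (rule prime_gt_1_nat)
  let ?G = "insert (unit_mat 0 1) (csp_ray p ` Pow {1..p - 1})"
  note e = csp_ray_entries[OF p1]
  have eq: "CSP_extreme_rays w p = {smul c R |c R. 0 < c \<and> R \<in> ?G}"
  proof (intro set_eqI iffI)
    fix A assume "A \<in> CSP_extreme_rays w p"
    then show "A \<in> {smul c R |c R. 0 < c \<and> R \<in> ?G}"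
      by (rule extreme_ray_classified[OF assms]) blast
  next
    fix A assume "A \<in> {smul c R |c R. 0 < c \<and> R \<in> ?G}"
    then show "A \<in> CSP_extreme_rays w p"
      using smul_extreme[OF assms] csp_ray_extreme[OF assms] unit_mat_extreme[OF assms] by auto
  qed
  have E: "unit_mat 0 (Suc 0) 0 (Suc 0) = 1" "unit_mat 0 (Suc 0) 0 p = 0"
    using p1 by (auto simp: unit_mat_def)
  have "card (CSP_extreme_rays w p // ray_equiv (CSP_extreme_rays w p)) = card ?G"
    unfolding eq
  proof (rule card_quotient_ray_equiv)
    fix R R' c assume R: "R \<in> ?G" "R' \<in> ?G" and c: "0 < c" "R' = smul c R"
    \<comment> \<open>All generators are normalised to have a 1 at \<open>(0, 1)\<close> or at \<open>(0, p)\<close>, which fixes the factor.\<close>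
    have v: "(X 0 (Suc 0), X 0 p) = (if X = unit_mat 0 1 then (1, 0) else (0, 1))" if "X \<in> ?G" for X
      using that e E by auto
    have "R' 0 (Suc 0) = c * R 0 (Suc 0)" "R' 0 p = c * R 0 p" using c(2) by (simp_all add: smul_def)
    then have "c = 1" using v[OF R(1)] v[OF R(2)] c(1) by (auto split: if_splits)
    then show "R' = R" using c(2) by (simp add: smul_def)
  qed
  also have "\<dots> = 2 ^ (p - 1) + 1"
  proof -
    have "inj_on (csp_ray p) (Pow {1..p - 1})"
    proof (rule inj_onI)
      fix I K assume IK: "I \<in> Pow {1..p - 1}" "K \<in> Pow {1..p - 1}" "csp_ray p I = csp_ray p K"
      have mem: "i \<in> L \<longleftrightarrow> i \<in> {1..<p} \<and> csp_ray p L i p \<noteq> 0" if "L \<in> Pow {1..p - 1}" for L i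
      proof -
        have L: "L \<subseteq> {1..p - 1}" using that by simp
        show ?thesis
        proof (cases "i \<in> {1..<p}")
          case True
          then show ?thesis using e(3)[OF L True] card_subset_less[OF p1 L] by simp
        next
          case False
          then have "i \<notin> {1..p - 1}" using p1 by auto
          then show ?thesis using L False by blast
        qed
      qed
      show "I = K"
        by (rule set_eqI) (simp only: mem[OF IK(1)] mem[OF IK(2)] IK(3))
    qed
    moreover have "unit_mat 0 1 \<notin> csp_ray p ` Pow {1..p - 1}"
    proof
      assume "unit_mat 0 1 \<in> csp_ray p ` Pow {1..p - 1}"
      then obtain I where "I \<subseteq> {1..p - 1}" "unit_mat 0 1 = csp_ray p I" by auto
      with e(1)[of I] E(2) show False by simp
    qed
    ultimately show ?thesis by (simp add: card_image card_Pow)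
  qed
  finally show ?thesis using eq by blast
qed

end
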